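(* Let $m,n$ be positive integers with $\gcd(m,n)=1$ and $d=m+n$. Let $v_0=(0,\ldots,0)\in\mathbb R^d$ and, for $i=1,\ldots,d$, $v_i={\bf e}_i+{\bf e}_{i+1}+\cdots+{\bf e}_{i+m-1}$, with indices of the standard unit vectors taken modulo $d$ (${\bf e}_{d+j}={\bf e}_j$). Let $\mathcal P=\mathrm{conv}\{v_0,v_1,\ldots,v_d\}$ and $\delta(\mathcal P)=(\delta_0,\ldots,\delta_d)$ its $\delta$-vector. Then for each $1\le i\le d$, the residue class of $im$ in $\mathbb Z/d\mathbb Z$ lies in $\{\overline1,\overline2,\ldots,\overline{m-1}\}$ if and only if $\delta_i=1$. Moreover, $\delta(\mathcal P)$ is shifted symmetric, i.e. $\delta_{i+1}=\delta_{d-i}$ for each $0\le i\le\lfloor(d-1)/2\rfloor$.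
   Context: For an integral convex polytope $\mathcal P\subset\mathbb R^N$ of dimension $d$, let $i(\mathcal P,n)=|n\mathcal P\cap\mathbb Z^N|$. The $\delta$-vector $\delta(\mathcal P)=(\delta_0,\ldots,\delta_d)$ is defined by $(1-\lambda)^{d+1}\bigl[1+\sum_{n\ge1}i(\mathcal P,n)\lambda^n\bigr]=\sum_{i=0}^d\delta_i\lambda^i$. For an integer $a$, $\overline a$ denotes its class in $\mathbb Z/d\mathbb Z$. *)

theory Defs
  imports
    "HOL-Analysis.Analysis"
    "HOL-Computational_Algebra.Formal_Power_Series"
    "HOL-Number_Theory.Cong"
begin

definition lattice_count :: "(real ^ 'n) set \<Rightarrow> nat \<Rightarrow> nat" where
  "lattice_count P k = card ((\<lambda>x. real k *\<^sub>R x) ` P \<inter> {z. \<forall>j. z $ j \<in> \<int>})"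

text \<open>The constant term is 1 by convention, as in $1 + \sum_{k \ge 1} i(P,k) \lambda^k$.\<close>

definition ehrhart_series :: "(real ^ 'n) set \<Rightarrow> int fps" where
  "ehrhart_series P = Abs_fps (\<lambda>k. if k = 0 then 1 else int (lattice_count P k))"

text \<open>The \<open>i\<close>-th entry of the $\delta$-vector is read off as a coefficient of
  $(1-\lambda)^{\dim P+1}$ times the Ehrhart series; for a nonempty integral convex
  polytope the product is a polynomial of degree at most $\dim P$, so the entries with
  \<open>i \<le> dim P\<close> are the $\delta$-vector. The truncation \<open>nat\<close> is harmless there,
  since \<open>aff_dim\<close> is negative only for the empty set.\<close>

definition delta_vector :: "(real ^ 'n) set \<Rightarrow> nat \<Rightarrow> int" where
  "delta_vector P i = fps_nth ((1 - fps_X) ^ (nat (aff_dim P) + 1) * ehrhart_series P) i"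

text \<open>The argument \<open>e\<close> is the list of standard unit vectors, continued periodically to all
  natural numbers; \<open>cyclic_vertex\<close> is used with indices \<open>i \<ge> 1\<close>.\<close>

definition cyclic_vertex :: "(nat \<Rightarrow> real ^ 'n) \<Rightarrow> nat \<Rightarrow> nat \<Rightarrow> real ^ 'n" where
  "cyclic_vertex e m i = (\<Sum>j\<in>{i..<i + m}. e j)"

definition cyclic_simplex :: "(nat \<Rightarrow> real ^ 'n) \<Rightarrow> nat \<Rightarrow> nat \<Rightarrow> (real ^ 'n) set" where
  "cyclic_simplex e m d = convex hull (insert 0 (cyclic_vertex e m ` {1..d}))"

end

theory Submission
  imports Defs
begin

text \<open>
  Write a point as $\sum_i c_i v_i$. Its $(j+m)$-th coordinate is $c_{j+1} + \cdots + c_{j+m}$, so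
  for a lattice point the differences $c_{j+m} - c_j$ are integers. As $m$ is prime to $d$,
  all $c_i$ then have the same fractional part, and $m c_0$ is an integer; so
  the lattice points are exactly the points with $c_i = a_i + t/m$ for integers $a_i$ and one
  $t \in \{0,\ldots,m-1\}$. Counting those with $c_i \ge 0$ and $\sum_i c_i \le k$ for each $t$
  gives the Ehrhart series $\sum_{t<m} \lambda^{\lceil td/m\rceil} / (1-\lambda)^{d+1}$, hence
  $\delta_i$ is the number of $t < m$ with $\lceil td/m\rceil = i$. Such a $t$ is the quotient of
  $im$ by $d$, and it exists iff the remainder lies in $\{1,\ldots,m-1\}$. The symmetry follows
  from $(i+1)m + (d-i)m \equiv m$ modulo $d$.
\<close>

section \<open>Dilates of polytopes with 0 among the generators\<close>

text \<open>The generator 0 absorbs the missing weight \<open>1 - sum c I\<close>, so the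
  coefficients need only sum to at most 1.\<close>

lemma convex_hull_insert_0_image:
  fixes v :: "nat \<Rightarrow> 'a::real_vector"
  assumes "finite I"
  shows "convex hull (insert 0 (v ` I)) =
    {\<Sum>i\<in>I. c i *\<^sub>R v i | c. (\<forall>i\<in>I. 0 \<le> c i) \<and> sum c I \<le> (1::real)}" (is "_ = ?T")
proof
  have "convex ?T"
  proof (rule convexI, clarify)
    fix a b :: real and c c' :: "nat \<Rightarrow> real"
    assume ab: "0 \<le> a" "0 \<le> b" "a + b = 1"
      and c: "\<forall>i\<in>I. 0 \<le> c i" "sum c I \<le> 1" and c': "\<forall>i\<in>I. 0 \<le> c' i" "sum c' I \<le> 1"
    have "sum (\<lambda>i. a * c i + b * c' i) I = a * sum c I + b * sum c' I"
      by (simp add: sum.distrib sum_distrib_left)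
    also have "\<dots> \<le> 1"
      using convex_bound_le[OF c(2) c'(2) ab] by simp
    finally show "\<exists>u. a *\<^sub>R (\<Sum>i\<in>I. c i *\<^sub>R v i) + b *\<^sub>R (\<Sum>i\<in>I. c' i *\<^sub>R v i) = (\<Sum>i\<in>I. u i *\<^sub>R v i)
        \<and> (\<forall>i\<in>I. 0 \<le> u i) \<and> sum u I \<le> 1"
      using ab c c'
      by (intro exI[of _ "\<lambda>i. a * c i + b * c' i"])
        (simp add: scaleR_add_left sum.distrib scaleR_sum_right)
  qed
  moreover have "insert 0 (v ` I) \<subseteq> ?T"
  proof -
    have "0 \<in> ?T" by (auto intro!: exI[of _ "\<lambda>_. 0"])
    moreover have "v i \<in> ?T" if "i \<in> I" for i
    proof -
      have "(\<Sum>j\<in>I. (if j = i then 1 else (0::real)) *\<^sub>R v j) = v i"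
        using assms that by (simp add: if_distrib[of "\<lambda>r. r *\<^sub>R _"] cong: if_cong)
      moreover have "(\<Sum>j\<in>I. (if j = i then 1 else (0::real))) = 1"
        using assms that by simp
      ultimately show ?thesis
        by (intro CollectI exI[of _ "\<lambda>j. if j = i then 1 else 0"]) auto
    qed
    ultimately show ?thesis by blast
  qed
  ultimately show "convex hull (insert 0 (v ` I)) \<subseteq> ?T"
    by (intro hull_minimal)
next
  show "?T \<subseteq> convex hull (insert 0 (v ` I))"
  proof clarify
    fix c :: "nat \<Rightarrow> real" assume c: "\<forall>i\<in>I. 0 \<le> c i" "sum c I \<le> 1"
    let ?C = "convex hull (insert 0 (v ` I))"
    have mem: "v i \<in> ?C" if "i \<in> I" for i using that by (simp add: hull_inc)
    have zero: "0 \<in> ?C" by (simp add: hull_inc)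
    show "(\<Sum>i\<in>I. c i *\<^sub>R v i) \<in> ?C"
    proof (cases "sum c I = 0")
      case True
      then have "\<forall>i\<in>I. c i = 0" using assms c by (simp add: sum_nonneg_eq_0_iff)
      then show ?thesis using zero by simp
    next
      case False
      then have pos: "sum c I > 0" using c by (simp add: order_less_le sum_nonneg)
      \<comment> \<open>Normalised coefficients give a point of the hull, which is then contracted
        towards 0 by the factor \<open>sum c I\<close>.\<close>
      have "(\<Sum>i\<in>I. (c i / sum c I) *\<^sub>R v i) \<in> ?C"
        using assms c pos mem
        by (intro convex_sum) (auto simp flip: sum_divide_distrib)
      then have "(1 - sum c I) *\<^sub>R 0 + sum c I *\<^sub>R (\<Sum>i\<in>I. (c i / sum c I) *\<^sub>R v i) \<in> ?C"
        using zero pos c by (intro convexD) auto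
      then show ?thesis using pos by (simp add: scaleR_sum_right)
    qed
  qed
qed

lemma scaled_convex_hull_insert_0_image:
  fixes v :: "nat \<Rightarrow> 'a::real_vector"
  assumes "finite I" and "k \<ge> 0"
  shows "(\<lambda>x. k *\<^sub>R x) ` (convex hull (insert 0 (v ` I))) =
    {\<Sum>i\<in>I. c i *\<^sub>R v i | c. (\<forall>i\<in>I. 0 \<le> c i) \<and> sum c I \<le> (k::real)}" (is "?L = ?R")
proof
  show "?L \<subseteq> ?R"
  proof clarify
    fix x assume "x \<in> convex hull (insert 0 (v ` I))"
    then obtain c where c: "x = (\<Sum>i\<in>I. c i *\<^sub>R v i)" "\<forall>i\<in>I. 0 \<le> c i" "sum c I \<le> 1"
      unfolding convex_hull_insert_0_image[OF assms(1)] by blast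
    show "\<exists>c. k *\<^sub>R x = (\<Sum>i\<in>I. c i *\<^sub>R v i) \<and> (\<forall>i\<in>I. 0 \<le> c i) \<and> sum c I \<le> k"
      using c assms(2) mult_left_mono[OF c(3) assms(2)]
      by (intro exI[of _ "\<lambda>i. k * c i"]) (simp add: scaleR_sum_right sum_distrib_left)
  qed
next
  show "?R \<subseteq> ?L"
  proof clarify
    fix c assume c: "\<forall>i\<in>I. 0 \<le> c i" "sum c I \<le> k"
    show "(\<Sum>i\<in>I. c i *\<^sub>R v i) \<in> ?L"
    proof (cases "k = 0")
      case True
      then have "\<forall>i\<in>I. c i = 0"
        using assms(1) c sum_nonneg_eq_0_iff[of I c] sum_nonneg[of I c] by simp
      moreover have "0 \<in> convex hull (insert 0 (v ` I))" by (simp add: hull_inc)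
      ultimately show ?thesis using True by force
    next
      case False
      then have "k > 0" using assms by simp
      then have "(\<Sum>i\<in>I. (c i / k) *\<^sub>R v i) \<in> convex hull (insert 0 (v ` I))"
        unfolding convex_hull_insert_0_image[OF assms(1)] using c
        by (intro CollectI exI[of _ "\<lambda>i. c i / k"]) (simp flip: sum_divide_distrib)
      moreover have "k *\<^sub>R (\<Sum>i\<in>I. (c i / k) *\<^sub>R v i) = (\<Sum>i\<in>I. c i *\<^sub>R v i)"
        using \<open>k > 0\<close> by (simp add: scaleR_sum_right)
      ultimately show ?thesis
        by (intro image_eqI[where x = "\<Sum>i\<in>I. (c i / k) *\<^sub>R v i"]) simp_all
    qed
  qed
qed

section \<open>Coprime steps and the binomial series\<close>

text \<open>Applied with \<open>A = {0}\<close> (linear independence of the $v_i$) and \<open>A = \<int>\<close> (lattice points).\<close>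

lemma diff_mem_of_coprime_steps:
  fixes g :: "nat \<Rightarrow> 'a::ab_group_add"
  assumes "0 \<in> A" and "\<And>a b. a \<in> A \<Longrightarrow> b \<in> A \<Longrightarrow> a + b \<in> A"
    and per: "\<And>j. g (d + j) = g j"
    and step: "\<And>j. g (j + m) - g j \<in> A"
    and "coprime m d"
  shows "g j - g 0 \<in> A"
proof -
  have mult: "g (q * m) - g 0 \<in> A" for q
  proof (induction q)
    case (Suc q)
    from assms(2)[OF step[of "q * m"] Suc] show ?case by (simp add: algebra_simps)
  qed (simp add: assms(1))
  have per': "g (i + r * d) = g i" for i r
    by (induction r) (simp_all add: per add.left_commute)
  have g_mod: "g i = g (i mod d)" for i
    using per'[of "i mod d" "i div d"] by simp
  \<comment> \<open>\<open>x\<close> inverts \<open>m\<close> modulo \<open>d\<close>, so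
    \<open>x * j\<close> steps of length \<open>m\<close> lead from 0 to an index congruent to
    \<open>j\<close>.\<close>
  obtain x where x: "[m * x = 1] (mod d)"
    using cong_solve_coprime_nat[OF assms(5)] by auto
  then have "[x * j * m = j] (mod d)"
    using cong_scalar_right[OF x, of j] by (simp add: mult.commute mult.left_commute)
  then have "g (x * j * m) = g j"
    using g_mod unfolding cong_def by metis
  then show ?thesis using mult[of "x * j"] by simp
qed

text \<open>Multiplication by \<open>1 - fps_X\<close> takes differences in \<open>k\<close>, which
  by Pascal's rule lowers \<open>n\<close> by one; \<open>n = 0\<close> is the geometric
  series.\<close>

lemma one_minus_fps_X_power_mult_binomial:
  "(1 - fps_X) ^ Suc n * Abs_fps (\<lambda>k. of_nat ((k + n) choose n)) = (1 :: 'a::comm_ring_1 fps)"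
proof (induction n)
  case 0
  show ?case by (rule fps_ext) (auto simp: left_diff_distrib)
next
  case (Suc n)
  have "(1 - fps_X) * Abs_fps (\<lambda>k. of_nat ((k + Suc n) choose Suc n)) =
      (Abs_fps (\<lambda>k. of_nat ((k + n) choose n)) :: 'a fps)"
  proof (rule fps_ext)
    fix k
    show "fps_nth ((1 - fps_X) * Abs_fps (\<lambda>k. of_nat ((k + Suc n) choose Suc n))) k =
      fps_nth (Abs_fps (\<lambda>k. of_nat ((k + n) choose n)) :: 'a fps) k"
      by (cases k) (simp_all add: left_diff_distrib binomial_eq_0)
  qed
  then show ?case using Suc by (simp add: power_Suc2 mult.assoc del: power_Suc)
qed

section \<open>Cyclic indices and coordinates\<close>

text \<open>With \<open>n = d - m\<close>, positivity of \<open>n\<close> reads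
  \<open>m < d\<close>, and \<open>gcd m n = 1\<close> reads \<open>coprime m d\<close>.\<close>

locale cyclic_frame =
  fixes e :: "nat \<Rightarrow> real ^ 'd" and m d :: nat
  assumes m_pos: "0 < m" and m_less: "m < d" and coprime_m_d: "coprime m d"
    and bij_e: "bij_betw e {1..d} Basis"
    and e_periodic: "e (d + j) = e j"
begin

text \<open>The linear map sending \<open>e i\<close> to the vertex v_i for \<open>i\<close> in
  \<open>{1..d}\<close>. The coordinates of \<open>x\<close> become the coefficients c_i, so the
  cyclic simplex is the image of the standard simplex.\<close>

definition frame_map :: "real ^ 'd \<Rightarrow> real ^ 'd" where
  "frame_map x = (\<Sum>i\<in>{1..d}. (x \<bullet> e i) *\<^sub>R cyclic_vertex e m i)"

definition of_coords :: "(nat \<Rightarrow> real) \<Rightarrow> real ^ 'd" where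
  "of_coords c = (\<Sum>i\<in>{1..d}. c i *\<^sub>R e i)"

lemma obtain_representative:
  obtains i' where "i' \<in> {1..d}" "[i = i'] (mod d)" "e i = e i'"
proof -
  have "e (j + q * d) = e j" for j q
    by (induction q) (simp_all add: e_periodic add.left_commute)
  from this[of "i mod d" "i div d"] have *: "e i = e (i mod d)" by simp
  show ?thesis
  proof (cases "i mod d = 0")
    \<comment> \<open>Representatives run from 1 to \<open>d\<close>, so the residue 0 is
      represented by \<open>d\<close>.\<close>
    case True
    then show ?thesis
      using that[of d] * e_periodic[of 0] m_less by (simp add: cong_def)
  next
    case False
    then show ?thesis
      using that[of "i mod d"] * m_less by (simp add: cong_def less_imp_le)
  qed
qed

lemma e_eq_iff: "e i = e j \<longleftrightarrow> [i = j] (mod d)"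
proof -
  obtain i' where i': "i' \<in> {1..d}" "[i = i'] (mod d)" "e i = e i'"
    by (rule obtain_representative)
  obtain j' where j': "j' \<in> {1..d}" "[j = j'] (mod d)" "e j = e j'"
    by (rule obtain_representative)
  have "[i' = j'] (mod d) \<longleftrightarrow> i' = j'"
  proof
    assume *: "[i' = j'] (mod d)"
    show "i' = j'"
    proof (cases "i' = d \<or> j' = d")
      \<comment> \<open>The only multiple of \<open>d\<close> in \<open>{1..d}\<close> is
        \<open>d\<close> itself; all other indices are their own residues.\<close>
      case True
      then have "d dvd i'" "d dvd j'"
        using * by (auto simp: cong_def dvd_eq_mod_eq_0)
      then show ?thesis
        using dvd_imp_le[of d i'] dvd_imp_le[of d j'] i'(1) j'(1) by simp
    next
      case False
      then show ?thesis using * i'(1) j'(1) by (simp add: cong_def)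
    qed
  qed simp
  moreover have "e i' = e j' \<longleftrightarrow> i' = j'"
    using bij_e i'(1) j'(1) by (auto simp: bij_betw_def inj_on_eq_iff)
  moreover have "[i = j] (mod d) \<longleftrightarrow> [i' = j'] (mod d)"
    using i'(2) j'(2) by (simp add: cong_def)
  ultimately show ?thesis using i'(3) j'(3) by simp
qed

lemma e_in_Basis: "e i \<in> Basis"
  using obtain_representative[of i] bij_e by (metis bij_betwE)

lemma inner_e: "e i \<bullet> e j = (if [i = j] (mod d) then 1 else 0)"
  using inner_Basis[OF e_in_Basis e_in_Basis, of i j] by (simp add: e_eq_iff)

lemma inner_e_shift: "e (i + s) \<bullet> e (j + s) = e i \<bullet> e j"
  by (simp add: inner_e cong_add_rcancel_nat)

lemma inner_periodic: "x \<bullet> e (d + j) = x \<bullet> e j"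
  by (simp add: e_periodic)

lemma Basis_eq_image: "Basis = e ` {1..d}"
  using bij_e by (simp add: bij_betw_def)

lemma of_coords_inner:
  assumes "j \<in> {1..d}"
  shows "of_coords c \<bullet> e j = c j"
proof -
  have "e i \<bullet> e j = (if i = j then 1 else 0)" if "i \<in> {1..d}" for i
    using assms that bij_e inner_Basis[OF e_in_Basis e_in_Basis, of i j]
    by (auto simp: bij_betw_def inj_on_eq_iff)
  then have "of_coords c \<bullet> e j = (\<Sum>i\<in>{1..d}. if i = j then c i else 0)"
    unfolding of_coords_def inner_sum_left by (intro sum.cong) auto
  then show ?thesis using assms by simp
qed

lemma of_coords_inner_eq: "of_coords (\<lambda>i. x \<bullet> e i) = x"
proof -
  have "inj_on e {1..d}" using bij_e by (simp add: bij_betw_def)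
  then have "of_coords (\<lambda>i. x \<bullet> e i) = (\<Sum>b\<in>Basis. (x \<bullet> b) *\<^sub>R b)"
    unfolding of_coords_def Basis_eq_image by (simp add: sum.reindex)
  then show ?thesis by (simp add: euclidean_representation)
qed

section \<open>The map from coefficients to points\<close>

text \<open>The basis vector \<open>e (j + m)\<close> occurs in v_i exactly when \<open>i\<close> is
  congruent to one of j+1, ..., j+m. Adding \<open>m\<close> to the index avoids truncated
  subtraction.\<close>

lemma frame_map_inner:
  "frame_map x \<bullet> e (j + m) = (\<Sum>s<m. x \<bullet> e (j + Suc s))"
proof -
  have vertex: "cyclic_vertex e m i = (\<Sum>s<m. e (i + s))" for i
    unfolding cyclic_vertex_def
    using sum.shift_bounds_nat_ivl[of e 0 i m] by (simp add: add.commute atLeast0LessThan)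
  have "frame_map x \<bullet> e (j + m) =
      (\<Sum>s<m. \<Sum>i\<in>{1..d}. (x \<bullet> e i) * (e (i + s) \<bullet> e (j + m)))"
    unfolding frame_map_def vertex inner_sum_left inner_scaleR_left sum_distrib_left
    by (rule sum.swap)
  also have "\<dots> = (\<Sum>s<m. x \<bullet> e (j + m - s))"
  proof (rule sum.cong)
    fix s assume "s \<in> {..<m}"
    then have "e (j + m) = e (j + m - s + s)" by simp
    then have "(\<Sum>i\<in>{1..d}. (x \<bullet> e i) * (e (i + s) \<bullet> e (j + m))) =
        (\<Sum>i\<in>{1..d}. (x \<bullet> e i) * (e i \<bullet> e (j + m - s)))"
      by (simp only: inner_e_shift)
    also have "\<dots> = of_coords (\<lambda>i. x \<bullet> e i) \<bullet> e (j + m - s)"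
      by (simp add: of_coords_def inner_sum_left)
    finally show "(\<Sum>i\<in>{1..d}. (x \<bullet> e i) * (e (i + s) \<bullet> e (j + m))) = x \<bullet> e (j + m - s)"
      by (simp add: of_coords_inner_eq)
  qed simp
  \<comment> \<open>Prepares the reversal of the summation order, s to m-1-s.\<close>
  also have "\<dots> = (\<Sum>s<m. x \<bullet> e (j + Suc (m - Suc s)))"
    by (intro sum.cong) (auto simp: Suc_diff_Suc)
  also have "\<dots> = (\<Sum>s<m. x \<bullet> e (j + Suc s))"
    by (rule sum.nat_diff_reindex[of "\<lambda>s. x \<bullet> e (j + Suc s)"])
  finally show ?thesis .
qed

text \<open>Two neighbouring windows of length \<open>m\<close> differ only in their end terms. The
  shift by one period \<open>d\<close> keeps the index j-1 a natural number at
  \<open>j = 0\<close>.\<close>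

lemma frame_map_inner_diff:
  "x \<bullet> e (j + m) - x \<bullet> e j =
    frame_map x \<bullet> e (j + d + m) - frame_map x \<bullet> e (j + d - 1 + m)"
proof -
  have *: "Suc (j + d - 1) = j + d" using m_less by simp
  have "frame_map x \<bullet> e (j + d + m) - frame_map x \<bullet> e (j + d - 1 + m) =
      (\<Sum>s<m. x \<bullet> e (j + d + Suc s) - x \<bullet> e (j + d + s))"
    unfolding frame_map_inner sum_subtractf
    using * by (metis (no_types, lifting) add_Suc_shift)
  also have "\<dots> = x \<bullet> e (j + d + m) - x \<bullet> e (j + d)"
    using sum_lessThan_telescope[of "\<lambda>s. x \<bullet> e (j + d + s)" m] by simp
  also have "\<dots> = x \<bullet> e (j + m) - x \<bullet> e j"
    using inner_periodic[of x "j + m"] inner_periodic[of x j] by (simp add: add_ac)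
  finally show ?thesis by simp
qed

lemma linear_frame_map: "linear frame_map"
  unfolding frame_map_def
  by (rule linearI) (simp_all add: inner_add_left scaleR_add_left sum.distrib scaleR_sum_right)

text \<open>On the kernel the steps of length \<open>m\<close> do not change the coordinates, so all
  are equal by coprimality; a window sum then says that \<open>m\<close> times their common value is
  0.\<close>

lemma inj_frame_map: "inj frame_map"
proof (rule linear_injective_0[OF linear_frame_map, THEN iffD2], intro allI impI)
  fix x assume zero: "frame_map x = 0"
  have const: "x \<bullet> e j = x \<bullet> e 0" for j
    using diff_mem_of_coprime_steps[of "{0}" "\<lambda>j. x \<bullet> e j" d m j]
      frame_map_inner_diff[of x] coprime_m_d
    by (simp add: zero inner_periodic)
  have "(\<Sum>s<m. x \<bullet> e (0 + Suc s)) = 0"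
    using frame_map_inner[of x 0] zero by simp
  then have "real m * (x \<bullet> e 0) = 0"
    by (subst (asm) const) simp
  then have "x \<bullet> e j = 0 \<bullet> e j" for j
    using m_pos const[of j] by simp
  then show "x = 0"
    by (metis euclidean_eqI Basis_eq_image imageE)
qed

section \<open>Lattice points in terms of coefficients\<close>

definition lattice :: "(real ^ 'd) set" where
  "lattice = {z. \<forall>j. z $ j \<in> \<int>}"

lemma mem_lattice_iff: "z \<in> lattice \<longleftrightarrow> (\<forall>j. z \<bullet> e j \<in> \<int>)"
proof -
  have "z \<in> lattice \<longleftrightarrow> (\<forall>b\<in>Basis. z \<bullet> b \<in> \<int>)"
    unfolding lattice_def by (auto simp: Basis_vec_def inner_axis)
  then show ?thesis
    using e_in_Basis by (metis Basis_eq_image imageE)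
qed

text \<open>Forward, all coordinates agree modulo 1, so a window sum shows that \<open>m\<close>
  times one of them is an integer. Backward, \<open>m\<close> terms congruent to t/m modulo 1 add up
  to an integer.\<close>

lemma frame_map_mem_lattice_iff:
  "frame_map x \<in> lattice \<longleftrightarrow> (\<exists>t<m. \<forall>j. x \<bullet> e j - real t / real m \<in> \<int>)"
proof
  assume L: "frame_map x \<in> lattice"
  have diff: "x \<bullet> e j - x \<bullet> e 0 \<in> \<int>" for j
    using L frame_map_inner_diff[of x] coprime_m_d
    by (intro diff_mem_of_coprime_steps[of \<int> "\<lambda>j. x \<bullet> e j" d m])
      (auto simp: mem_lattice_iff inner_periodic)
  have "frame_map x \<bullet> e (0 + m) - (\<Sum>s<m. x \<bullet> e (0 + Suc s) - x \<bullet> e 0) \<in> \<int>"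
    using L diff by (intro Ints_diff[OF _ Ints_sum]) (simp_all add: mem_lattice_iff)
  then have "real m * (x \<bullet> e 0) \<in> \<int>"
    by (simp add: sum_subtractf frame_map_inner[of x 0, simplified])
  then obtain p where p: "real m * (x \<bullet> e 0) = of_int p"
    by (auto elim: Ints_cases)
  \<comment> \<open>The common fractional part is that of p/m, so its numerator is \<open>p\<close>
    reduced modulo \<open>m\<close>.\<close>
  define t where "t = nat (p mod int m)"
  have t: "int t = p mod int m" "t < m"
    using m_pos by (auto simp: t_def nat_less_iff)
  have "p = int m * (p div int m) + int t"
    using t by simp
  then have "real m * (x \<bullet> e 0) = real m * of_int (p div int m) + real t"
    using p by (metis of_int_add of_int_mult of_int_of_nat_eq)
  then have "x \<bullet> e 0 - real t / real m = of_int (p div int m)"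
    using m_pos by (simp add: field_simps)
  then have "x \<bullet> e 0 - real t / real m \<in> \<int>" by simp
  then have "x \<bullet> e j - real t / real m \<in> \<int>" for j
    using Ints_add[OF diff[of j], of "x \<bullet> e 0 - real t / real m"] by simp
  then show "\<exists>t<m. \<forall>j. x \<bullet> e j - real t / real m \<in> \<int>"
    using t(2) by blast
next
  assume "\<exists>t<m. \<forall>j. x \<bullet> e j - real t / real m \<in> \<int>"
  then obtain t where t: "\<And>j. x \<bullet> e j - real t / real m \<in> \<int>" by blast
  have "frame_map x \<bullet> e j \<in> \<int>" for j
  proof -
    \<comment> \<open>One period is added so that \<open>j\<close> takes the form required by
      \<open>frame_map_inner\<close>.\<close>
    have "e j = e (j + d - m + m)"
      using e_periodic[of j] m_less by (simp add: add.commute)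
    then have "frame_map x \<bullet> e j = (\<Sum>s<m. x \<bullet> e (j + d - m + Suc s))"
      by (simp only: frame_map_inner)
    also have "\<dots> = (\<Sum>s<m. x \<bullet> e (j + d - m + Suc s) - real t / real m) + real t"
      using m_pos by (simp add: sum_subtractf)
    also have "\<dots> \<in> \<int>"
      using t by (intro Ints_add Ints_sum) auto
    finally show ?thesis .
  qed
  then show "frame_map x \<in> lattice" by (simp add: mem_lattice_iff)
qed

section \<open>Dilates and dimension of the cyclic simplex\<close>

lemma scaled_cyclic_simplex:
  "(\<lambda>x. real k *\<^sub>R x) ` cyclic_simplex e m d =
    frame_map ` {x. (\<forall>i\<in>{1..d}. 0 \<le> x \<bullet> e i) \<and> (\<Sum>i\<in>{1..d}. x \<bullet> e i) \<le> real k}" (is "?L = ?R")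
proof -
  have frame: "frame_map (of_coords c) = (\<Sum>i\<in>{1..d}. c i *\<^sub>R cyclic_vertex e m i)" for c
    unfolding frame_map_def by (intro sum.cong) (simp_all add: of_coords_inner)
  have L: "?L = {\<Sum>i\<in>{1..d}. c i *\<^sub>R cyclic_vertex e m i | c.
      (\<forall>i\<in>{1..d}. 0 \<le> c i) \<and> sum c {1..d} \<le> real k}"
    unfolding cyclic_simplex_def by (rule scaled_convex_hull_insert_0_image) simp_all
  show ?thesis
  proof
    show "?L \<subseteq> ?R"
    proof
      fix z assume "z \<in> ?L"
      then obtain c where c: "z = frame_map (of_coords c)"
          "\<forall>i\<in>{1..d}. 0 \<le> c i" "sum c {1..d} \<le> real k"
        unfolding L frame by blast
      have "(\<Sum>i\<in>{1..d}. of_coords c \<bullet> e i) = sum c {1..d}"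
        by (intro sum.cong refl of_coords_inner)
      then show "z \<in> ?R" using c by (auto simp: of_coords_inner)
    qed
    show "?R \<subseteq> ?L"
      unfolding L frame_map_def by (rule image_subsetI) auto
  qed
qed

text \<open>As 0 is a vertex, the affine dimension is the dimension of the span, and surjectivity of
  \<open>frame_map\<close> makes the v_i span the whole space.\<close>

lemma aff_dim_cyclic_simplex: "aff_dim (cyclic_simplex e m d) = int CARD('d)"
proof -
  let ?V = "insert 0 (cyclic_vertex e m ` {1..d})"
  have "surj frame_map"
    using linear_frame_map inj_frame_map by (rule linear_inj_imp_surj)
  moreover have "range frame_map \<subseteq> span ?V"
    unfolding frame_map_def
    by (intro image_subsetI span_sum span_scale span_base) auto
  ultimately have "span ?V = UNIV" by auto
  then have "dim (span ?V) = CARD('d)" by simp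
  moreover have "aff_dim ?V = int (dim ?V)"
    by (intro aff_dim_zero hull_inc) simp
  ultimately show ?thesis 
    by (simp only: cyclic_simplex_def aff_dim_convex_hull dim_span)
qed

section \<open>Counting the lattice points of a dilate\<close>

text \<open>\<open>box_height t\<close> is $\lceil td/m \rceil$, the least integer $\ge$ the coordinate sum
  of the box point all of whose $d$ coordinates are $t/m$.\<close>

definition box_height :: "nat \<Rightarrow> nat" where
  "box_height t = (t * d + m - 1) div m"

text \<open>The defining property of the ceiling; all later arguments about
  \<open>box_height\<close> go through it.\<close>

lemma box_height_le_iff: "box_height t \<le> k \<longleftrightarrow> t * d \<le> k * m"
proof -
  have "box_height t \<le> k \<longleftrightarrow> (t * d + m - 1) div m < Suc k"
    by (simp add: box_height_def less_Suc_eq_le)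
  also have "\<dots> \<longleftrightarrow> t * d + m - 1 < Suc k * m"
    using m_pos by (rule div_less_iff_less_mult)
  also have "\<dots> \<longleftrightarrow> t * d \<le> k * m"
    using m_pos by auto
  finally show ?thesis .
qed

text \<open>Entry 0 of the list is the slack that fills the coordinate sum up to \<open>k\<close>; entries
  $1,\ldots,d$ are the integer parts of the coordinates with respect to $v_1,\ldots,v_d$.\<close>

definition box_points :: "nat \<Rightarrow> (nat \<times> nat list) set" where
  "box_points k = (SIGMA t:{t. t < m \<and> box_height t \<le> k}.
    {l. length l = Suc d \<and> sum_list l = k - box_height t})"

text \<open>Stars and bars with \<open>d + 1\<close> parts, for each \<open>t\<close>
  separately.\<close>

lemma card_box_points:
  "card (box_points k) = (\<Sum>t | t < m \<and> box_height t \<le> k. (k - box_height t + d) choose d)"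
proof -
  have card_lists: "card {l :: nat list. length l = Suc d \<and> sum_list l = N} = (N + d) choose d" for N
    using card_length_sum_list[of "Suc d" N] binomial_symmetric[of N "N + d"] by simp
  \<comment> \<open>The binomial coefficient is positive, and a set of positive cardinality is
    finite.\<close>
  then have "finite {l :: nat list. length l = Suc d \<and> sum_list l = N}" for N
    by (intro card_ge_0_finite) (simp only: card_lists, simp)
  then show ?thesis
    unfolding box_points_def by (subst card_SigmaI) (auto simp only: card_lists finite_Collect_conjI finite_Collect_less_nat)
qed

definition box_point :: "nat \<times> nat list \<Rightarrow> real ^ 'd" where
  "box_point = (\<lambda>(t, l). of_coords (\<lambda>i. real (l ! i) + real t / real m))"

lemma box_point_inner:
  "i \<in> {1..d} \<Longrightarrow> box_point (t, l) \<bullet> e i = real (l ! i) + real t / real m"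
  by (simp add: box_point_def of_coords_inner)

lemma sum_list_Suc_length:
  fixes l :: "nat list"
  assumes "length l = Suc d"
  shows "sum_list l = l ! 0 + (\<Sum>i\<in>{1..d}. l ! i)"
  using assms unfolding sum_list_sum_nth
  by (simp add: sum.atLeast_Suc_atMost[of 0 d] atLeastLessThanSuc_atLeastAtMost del: sum.op_ivl_Suc)

text \<open>The first coordinate times \<open>m\<close> determines \<open>t\<close> modulo
  \<open>m\<close>; then the coordinates give entries 1 to \<open>d\<close>, and the prescribed
  total gives the slack.\<close>

lemma inj_on_box_point: "inj_on box_point (box_points k)"
proof (rule inj_onI, clarify)
  fix t l t' l'
  assume mem: "(t, l) \<in> box_points k" "(t', l') \<in> box_points k"
    and eq: "box_point (t, l) = box_point (t', l')"
  have coord: "real (l ! i) + real t / real m = real (l' ! i) + real t' / real m" if "i \<in> {1..d}" for i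
    using eq that by (metis box_point_inner)
  have "1 \<in> {1..d}" using m_less by simp
  from coord[OF this] have "real (m * l ! 1 + t) = real (m * l' ! 1 + t')"
    using m_pos by (simp add: field_simps)
  then have "(m * l ! 1 + t) mod m = (m * l' ! 1 + t') mod m"
    by (simp only: of_nat_eq_iff)
  then have t: "t = t'" using mem by (simp add: box_points_def)
  then have tail: "l ! i = l' ! i" if "i \<in> {1..d}" for i
    using coord[OF that] by simp
  then have "(\<Sum>i\<in>{1..d}. l ! i) = (\<Sum>i\<in>{1..d}. l' ! i)" by simp
  then have "l ! 0 = l' ! 0"
    using mem t sum_list_Suc_length[of l] sum_list_Suc_length[of l']
    by (simp add: box_points_def)
  then have "l ! i = l' ! i" if "i \<le> d" for i
    using tail[of i] that by (cases "i = 0") auto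
  then have "l = l'"
    using mem by (intro nth_equalityI) (auto simp: box_points_def)
  with t show "t = t' \<and> l = l'" by simp
qed

text \<open>The integer parts have an integer sum, so bounding the coordinate sum by
  \<open>k\<close> amounts to bounding that sum plus the rounded-up value of td/m by
  \<open>k\<close>. The slack turns this inequality into the equation in
  \<open>box_points\<close>.\<close>

lemma box_point_image:
  "box_point ` box_points k =
    {x. (\<forall>i\<in>{1..d}. 0 \<le> x \<bullet> e i) \<and> (\<Sum>i\<in>{1..d}. x \<bullet> e i) \<le> real k \<and>
        frame_map x \<in> lattice}" (is "_ = ?R")
proof
  show "box_point ` box_points k \<subseteq> ?R"
  proof clarify
    fix t l assume mem: "(t, l) \<in> box_points k"
    let ?x = "box_point (t, l)"
    have tm: "t < m" using mem by (simp add: box_points_def)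
    have "?x \<bullet> e j - real t / real m \<in> \<int>" for j
      using obtain_representative[of j] by (metis box_point_inner add_diff_cancel_right' Ints_of_nat)
    then have "frame_map ?x \<in> lattice"
      using tm by (auto simp: frame_map_mem_lattice_iff)
    moreover have "(\<Sum>i\<in>{1..d}. ?x \<bullet> e i) = real (\<Sum>i\<in>{1..d}. l ! i) + real d * (real t / real m)"
      by (simp add: box_point_inner sum.distrib)
    moreover have "real (\<Sum>i\<in>{1..d}. l ! i) + real (box_height t) \<le> real k"
      unfolding of_nat_add[symmetric] of_nat_le_iff
      using mem sum_list_Suc_length[of l] by (auto simp: box_points_def)
    moreover have "real d * (real t / real m) \<le> real (box_height t)"
    proof -
      have "real (t * d) \<le> real (box_height t * m)"
        using box_height_le_iff[of t "box_height t"] by (simp only: of_nat_le_iff order_refl)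
      then show ?thesis using m_pos by (simp add: field_simps)
    qed
    ultimately have "frame_map ?x \<in> lattice" "(\<Sum>i\<in>{1..d}. ?x \<bullet> e i) \<le> real k"
      by linarith+
    then show "(\<forall>i\<in>{1..d}. 0 \<le> ?x \<bullet> e i) \<and> (\<Sum>i\<in>{1..d}. ?x \<bullet> e i) \<le> real k \<and>
        frame_map ?x \<in> lattice"
      by (auto simp: box_point_inner)
  qed
next
  show "?R \<subseteq> box_point ` box_points k"
  proof clarify
    fix x assume nonneg: "\<forall>i\<in>{1..d}. 0 \<le> x \<bullet> e i" and le: "(\<Sum>i\<in>{1..d}. x \<bullet> e i) \<le> real k"
      and "frame_map x \<in> lattice"
    then obtain t where t: "t < m" "\<And>j. x \<bullet> e j - real t / real m \<in> \<int>"
      by (auto simp: frame_map_mem_lattice_iff)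
    have "\<forall>i\<in>{1..d}. \<exists>a::nat. x \<bullet> e i = real a + real t / real m"
    proof
      fix i assume i: "i \<in> {1..d}"
      obtain p where p: "x \<bullet> e i - real t / real m = of_int p"
        using t(2)[of i] by (auto elim: Ints_cases)
      have "real t / real m < 1" using t(1) by simp
      \<comment> \<open>A nonnegative coordinate minus a fraction below 1 exceeds -1, so its integer
        part is not negative.\<close>
      then have "of_int p > (-1 :: real)" using nonneg i p by force
      then have "p \<ge> 0" by linarith
      then have "x \<bullet> e i = real (nat p) + real t / real m" using p by simp
      then show "\<exists>a::nat. x \<bullet> e i = real a + real t / real m" ..
    qed
    then obtain a :: "nat \<Rightarrow> nat" where a: "\<And>i. i \<in> {1..d} \<Longrightarrow> x \<bullet> e i = real (a i) + real t / real m"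
      by (metis bchoice)
    have "(\<Sum>i\<in>{1..d}. x \<bullet> e i) = real (sum a {1..d}) + real d * (real t / real m)"
      by (simp add: a sum.distrib)
    with le have *: "real (sum a {1..d}) + real d * (real t / real m) \<le> real k" by simp
    moreover have "0 \<le> real d * (real t / real m)" by simp
    ultimately have sum_le: "sum a {1..d} \<le> k" by linarith
    have "real (t * d) \<le> real ((k - sum a {1..d}) * m)"
      using * m_pos sum_le by (simp add: of_nat_diff field_simps del: of_nat_sum)
    then have "t * d \<le> (k - sum a {1..d}) * m" by (simp only: of_nat_le_iff)
    then have height: "box_height t + sum a {1..d} \<le> k"
      using sum_le box_height_le_iff[of t "k - sum a {1..d}"] by simp
    \<comment> \<open>The slack heads the list and the map starts at 1, so position \<open>i\<close>
      holds \<open>a i\<close>.\<close>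
    define l where "l = (k - box_height t - sum a {1..d}) # map a [1..<Suc d]"
    have nth: "l ! i = a i" if "i \<in> {1..d}" for i
      using that by (auto simp: l_def nth_Cons' simp del: upt_Suc)
    have "sum_list (map a [1..<Suc d]) = sum a {1..d}"
      unfolding interv_sum_list_conv_sum_set_nat
      by (simp add: atLeastLessThanSuc_atLeastAtMost del: upt_Suc)
    then have "(t, l) \<in> box_points k"
      using t(1) height by (simp add: box_points_def l_def del: upt_Suc)
    moreover have "box_point (t, l) = x"
    proof -
      have "box_point (t, l) = of_coords (\<lambda>i. x \<bullet> e i)"
        unfolding box_point_def of_coords_def prod.case
        by (intro sum.cong refl) (simp only: nth a)
      then show ?thesis by (simp add: of_coords_inner_eq)
    qed
    ultimately show "x \<in> box_point ` box_points k" by (metis image_eqI)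
  qed
qed

lemma lattice_count_cyclic_simplex:
  "lattice_count (cyclic_simplex e m d) k =
    (\<Sum>t | t < m \<and> box_height t \<le> k. (k - box_height t + d) choose d)"
proof -
  have "(\<lambda>x. real k *\<^sub>R x) ` cyclic_simplex e m d \<inter> lattice = frame_map ` box_point ` box_points k"
    unfolding scaled_cyclic_simplex box_point_image by auto
  then have "lattice_count (cyclic_simplex e m d) k = card (box_point ` box_points k)"
    unfolding lattice_count_def lattice_def[symmetric]
    using inj_frame_map by (simp add: card_image inj_on_subset)
  then show ?thesis
    using inj_on_box_point by (simp add: card_image card_box_points)
qed

section \<open>Ehrhart series and delta-vector\<close>

text \<open>Each \<open>t\<close> contributes the binomial series, delayed by
  \<open>box_height t\<close>.\<close>

lemma ehrhart_series_cyclic_simplex: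
  "ehrhart_series (cyclic_simplex e m d) =
    (\<Sum>t<m. fps_X ^ box_height t) * Abs_fps (\<lambda>k. of_nat ((k + d) choose d))"
proof (rule fps_ext)
  fix k
  have "fps_nth (ehrhart_series (cyclic_simplex e m d)) k =
      int (lattice_count (cyclic_simplex e m d) k)"
  proof (cases "k = 0")
    case True
    \<comment> \<open>The constant term of the series is 1 by convention; it agrees with the count
      because only \<open>t = 0\<close> has height 0.\<close>
    have "{t. t < m \<and> box_height t \<le> 0} = {0}"
      using m_pos m_less by (auto simp: box_height_le_iff simp del: le_zero_eq)
    then have "lattice_count (cyclic_simplex e m d) 0 = 1"
      using box_height_le_iff[of 0 0] by (simp add: lattice_count_cyclic_simplex)
    then show ?thesis using True by (simp add: ehrhart_series_def)
  qed (simp add: ehrhart_series_def)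
  also have "\<dots> = (\<Sum>t<m. if box_height t \<le> k then int ((k - box_height t + d) choose d) else 0)"
    unfolding lattice_count_cyclic_simplex of_nat_sum
    by (intro sum.mono_neutral_cong_left) auto
  also have "\<dots> = fps_nth ((\<Sum>t<m. fps_X ^ box_height t) * Abs_fps (\<lambda>k. of_nat ((k + d) choose d))) k"
    by (auto simp: sum_distrib_right fps_sum_nth fps_X_power_mult_nth intro!: sum.cong)
  finally show "fps_nth (ehrhart_series (cyclic_simplex e m d)) k =
      fps_nth ((\<Sum>t<m. fps_X ^ box_height t) * Abs_fps (\<lambda>k. of_nat ((k + d) choose d))) k" .
qed

lemma delta_vector_cyclic_simplex:
  assumes "CARD('d) = d"
  shows "delta_vector (cyclic_simplex e m d) i = int (card {t. t < m \<and> box_height t = i})"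
proof -
  have "(1 - fps_X) ^ Suc d * ehrhart_series (cyclic_simplex e m d) =
      (\<Sum>t<m. fps_X ^ box_height t) *
        ((1 - fps_X) ^ Suc d * Abs_fps (\<lambda>k. of_nat ((k + d) choose d)) :: int fps)"
    unfolding ehrhart_series_cyclic_simplex by (simp only: mult.left_commute)
  also have "\<dots> = (\<Sum>t<m. fps_X ^ box_height t)"
    by (simp only: one_minus_fps_X_power_mult_binomial mult_1_right)
  finally have "delta_vector (cyclic_simplex e m d) i =
      fps_nth (\<Sum>t<m. fps_X ^ box_height t) i"
    using assms by (simp add: delta_vector_def aff_dim_cyclic_simplex)
  also have "\<dots> = (\<Sum>t\<in>{t\<in>{..<m}. box_height t = i}. 1)"
    unfolding fps_sum_nth fps_X_power_nth
    by (subst sum.inter_filter) (auto intro: sum.cong)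
  finally show ?thesis by simp
qed

section \<open>Heights and residues of im modulo d\<close>

text \<open>Height \<open>i\<close> means that i*m - t*d lies in 0, ..., m-1. Since
  \<open>m < d\<close>, this difference is the remainder of \<open>i * m\<close> by
  \<open>d\<close>, and \<open>t\<close> is the quotient.\<close>

lemma box_height_level:
  assumes "i \<in> {1..d}"
  shows "{t. t < m \<and> box_height t = i} = (if i * m mod d \<in> {1..<m} then {i * m div d} else {})"
proof -
  have eq_iff: "box_height t = i \<longleftrightarrow> t * d \<le> i * m \<and> i * m < t * d + m" for t
  proof -
    have "box_height t = i \<longleftrightarrow> box_height t \<le> i \<and> \<not> box_height t \<le> i - 1"
      using assms by auto
    also have "\<dots> \<longleftrightarrow> t * d \<le> i * m \<and> i * m < t * d + m"
      using assms m_pos by (cases i) (auto simp: box_height_le_iff)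
    finally show ?thesis .
  qed
  have "i * m mod d \<in> {1..<m} \<and> t = i * m div d" if t: "t < m" "box_height t = i" for t
  proof -
    obtain r where r: "i * m = t * d + r" "r < m"
      using t(2) unfolding eq_iff by (metis add_less_cancel_left le_Suc_ex)
    \<comment> \<open>If \<open>r = 0\<close>, coprimality makes \<open>m\<close> divide
      \<open>t < m\<close>; then \<open>t = 0\<close> and \<open>i * m = 0\<close>, against
      \<open>i >= 1\<close>.\<close>
    have "r \<noteq> 0"
    proof
      assume "r = 0"
      then have "m dvd t * d" using r(1) by (metis add.right_neutral dvd_triv_right)
      then have "m dvd t" using coprime_m_d by (simp add: coprime_dvd_mult_left_iff)
      then have "t = 0" using t(1) by (auto dest: dvd_imp_le)
      then show False using r \<open>r = 0\<close> assms m_pos by simp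
    qed
    then show ?thesis using r m_less by simp
  qed
  moreover have "i * m div d < m \<and> box_height (i * m div d) = i" if r: "i * m mod d \<in> {1..<m}"
  proof -
    have split: "i * m div d * d + i * m mod d = i * m" by simp
    \<comment> \<open>A positive remainder makes the next inequality strict, which yields a quotient
      below \<open>m\<close> even though \<open>i\<close> may equal \<open>d\<close>.\<close>
    have "0 < i * m mod d" using r by simp
    then have "i * m div d * d < i * m" using split by linarith
    also have "\<dots> \<le> m * d" using assms by simp
    finally have "i * m div d < m" by simp
    moreover have "i * m div d * d \<le> i * m" "i * m < i * m div d * d + m"
      using split r unfolding atLeastLessThan_iff by linarith+
    ultimately show ?thesis unfolding eq_iff by simp
  qed
  ultimately show ?thesis by auto
qed

lemma cong_range_iff: "(\<exists>r\<in>{1..<m}. [i * m = r] (mod d)) \<longleftrightarrow> i * m mod d \<in> {1..<m}"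
  using m_less by (auto simp: cong_def intro: bexI[of _ "i * m mod d"])

lemma delta_vector_cyclic_simplex_indicator:
  assumes "CARD('d) = d" and "i \<in> {1..d}"
  shows "delta_vector (cyclic_simplex e m d) i = of_bool (\<exists>r\<in>{1..<m}. [i * m = r] (mod d))"
  unfolding delta_vector_cyclic_simplex[OF assms(1)] box_height_level[OF assms(2)] cong_range_iff
  by simp

text \<open>Since (i + i')m = (d + 1)m is congruent to m, the residue \<open>r\<close> is exchanged
  with \<open>m - r\<close>.\<close>

lemma cong_range_symmetric:
  assumes "i + i' = Suc d" and "\<exists>r\<in>{1..<m}. [i * m = r] (mod d)"
  shows "\<exists>r\<in>{1..<m}. [i' * m = r] (mod d)"
proof -
  obtain r where r: "r \<in> {1..<m}" "[i * m = r] (mod d)" using assms(2) by blast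
  have "[i' * m + r = i' * m + i * m] (mod d)"
    using r(2) by (simp add: cong_add_lcancel_nat cong_sym)
  also have "i' * m + i * m = m + d * m"
    using assms(1) by (metis add.commute add_mult_distrib mult_Suc)
  also have "[m + d * m = (m - r) + r] (mod d)"
    using r(1) by (simp add: cong_def)
  finally have "[i' * m = m - r] (mod d)"
    by (simp only: cong_add_rcancel_nat)
  then show ?thesis using r(1) by (intro bexI[of _ "m - r"]) auto
qed

end

theorem theorem3p2:
  fixes m n d :: nat
    and e :: "nat \<Rightarrow> real ^ 'd"
    and P :: "(real ^ 'd) set"
  assumes "m > 0" and "n > 0" and "gcd m n = 1" and "d = m + n"
    and "CARD('d) = d"
    and "bij_betw e {1..d} (Basis :: (real ^ 'd) set)"
    and "\<And>j. e (d + j) = e j"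
    and "P = cyclic_simplex e m d"
  shows "(\<forall>i\<in>{1..d}. (\<exists>r\<in>{1..<m}. [i * m = r] (mod d)) \<longleftrightarrow> delta_vector P i = 1)
       \<and> (\<forall>i\<le>(d - 1) div 2. delta_vector P (i + 1) = delta_vector P (d - i))"
proof -
  have "coprime m d"
    using assms(3,4) by (simp add: coprime_iff_gcd_eq_1)
  then interpret cyclic_frame e m d
    using assms by unfold_locales auto
  note delta = delta_vector_cyclic_simplex_indicator[OF assms(5), folded assms(8)]
  \<comment> \<open>Both entries are 0-1 indicators at indices in \<open>{1..d}\<close> with sum
    \<open>d + 1\<close>, so the residue symmetry, used in both directions, equates them.\<close>
  have "delta_vector P (i + 1) = delta_vector P (d - i)" if "i \<le> (d - 1) div 2" for i
  proof -
    have "i < d" using that m_less by linarith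
    then have range: "i + 1 \<in> {1..d}" "d - i \<in> {1..d}"
      and sums: "(i + 1) + (d - i) = Suc d" "(d - i) + (i + 1) = Suc d"
      by auto
    show ?thesis
      unfolding delta[OF range(1)] delta[OF range(2)]
      using cong_range_symmetric[OF sums(1)] cong_range_symmetric[OF sums(2)]
      by (intro arg_cong[where f = of_bool] iffI)
  qed
  then show ?thesis by (simp add: delta)
qed

end
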